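(* Let $n\ge 2$ be an integer, let $e$ be an edge of the complete graph $K_n$ on $n$ vertices, and let $K_n-e$ be the graph obtained from $K_n$ by deleting the edge $e$ (keeping all vertices). Then: (i) the Randić characteristic polynomial of $K_n-e$ is $$RP(K_n-e,\lambda)=\lambda(\lambda-1)\left(\lambda+\tfrac{2}{n-1}\right)\left(\lambda+\tfrac{1}{n-1}\right)^{n-3};$$ (ii) the Randić energy of $K_n-e$ is $RE(K_n-e)=2$.
   Context: All graphs are finite and simple. For a graph $G$ with vertices $v_1,\dots,v_n$ of degrees $d_1,\dots,d_n$, the Randić matrix $R(G)$ is the $n\times n$ real symmetric matrix with $(i,j)$-entry $\frac{1}{\sqrt{d_id_j}}$ if $v_i$ and $v_j$ are adjacent, and $0$ otherwise. The Randić characteristic polynomial of $G$ is $RP(G,\lambda)=\det(\lambda I-R(G))$. The Randić energy of $G$ is $RE(G)=\sum_{i=1}^n|\rho_i|$, where $\rho_1,\dots,\rho_n$ are the eigenvalues of $R(G)$ counted with multiplicity.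
   Formalization: The formal theorem assumes n ≥ 3 instead of n ≥ 2: for n = 2 the graph K_2 − e has no edges, so its Randić matrix is 0, RP = λ² and RE = 0, and both (i) and (ii) fail. *)

theory Defs
  imports "Jordan_Normal_Form.Char_Poly" Complex_Main
begin

text \<open>
  A finite simple graph with vertices \<open>v\<^sub>1, \<dots>, v\<^sub>n\<close> is given by its number of vertices \<open>n\<close>
  and its set \<open>E\<close> of edges; the vertices are labelled \<open>0, \<dots>, n - 1\<close> and an edge is the set of
  its two end points.
\<close>

definition simple_graph :: "nat \<Rightarrow> nat set set \<Rightarrow> bool" where
  "simple_graph n E \<longleftrightarrow> (\<forall>e\<in>E. e \<subseteq> {..<n} \<and> card e = 2)"

definition degree_of :: "nat set set \<Rightarrow> nat \<Rightarrow> nat" where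
  "degree_of E v = card {e \<in> E. v \<in> e}"

definition randic_matrix :: "nat \<Rightarrow> nat set set \<Rightarrow> real mat" where
  "randic_matrix n E = mat n n (\<lambda>(i, j).
     if {i, j} \<in> E then 1 / sqrt (real (degree_of E i) * real (degree_of E j)) else 0)"

definition randic_char_poly :: "nat \<Rightarrow> nat set set \<Rightarrow> real poly" where
  "randic_char_poly n E = char_poly (randic_matrix n E)"

text \<open>
  For a simple graph the matrix is real symmetric, so all its eigenvalues are real and the
  multiplicity of an eigenvalue is its order as a root of the characteristic polynomial.
\<close>

definition randic_energy :: "nat \<Rightarrow> nat set set \<Rightarrow> real" where
  "randic_energy n E =
     (\<Sum>\<rho> | eigenvalue (randic_matrix n E) \<rho>. real (order \<rho> (randic_char_poly n E)) * \<bar>\<rho>\<bar>)"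

definition complete_edges :: "nat \<Rightarrow> nat set set" where
  "complete_edges n = {e. e \<subseteq> {..<n} \<and> card e = 2}"

lemma simple_graph_complete_minus: "simple_graph n (complete_edges n - F)"
  by (auto simp: simple_graph_def complete_edges_def)

text \<open>
  \<open>K\<^sub>2 - e\<close> has no edges, so its matrix vanishes and its energy is 0; the energy 2 of \<open>K\<^sub>n - e\<close>
  requires \<open>n \<ge> 3\<close>.
\<close>

lemma randic_energy_no_edges: "randic_energy n {} = 0"
proof -
  have R: "randic_matrix n {} = 0\<^sub>m n n"
    by (intro eq_matI) (auto simp: randic_matrix_def)
  have "\<rho> = 0" if "eigenvalue (0\<^sub>m n n :: real mat) \<rho>" for \<rho>
  proof -
    from that obtain v where v: "v \<in> carrier_vec n" "v \<noteq> 0\<^sub>v n" "0\<^sub>m n n *\<^sub>v v = \<rho> \<cdot>\<^sub>v v"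
      by (auto simp: eigenvalue_def eigenvector_def)
    from v(1,2) obtain i where i: "i < n" "v $ i \<noteq> 0"
      by (metis carrier_vecD eq_vecI index_zero_vec)
    have "(0\<^sub>m n n *\<^sub>v v) $ i = 0" using v(1) i by simp
    thus ?thesis using v(1,3) i by simp
  qed
  thus ?thesis unfolding randic_energy_def R by (intro sum.neutral) auto
qed

lemma randic_energy_K2_minus_edge:
  assumes "e \<in> complete_edges 2"
  shows "randic_energy 2 (complete_edges 2 - {e}) = 0"
proof -
  have "f = {..<2}" if "f \<in> complete_edges 2" for f
    using that card_subset_eq[of "{..<2::nat}" f] by (auto simp: complete_edges_def)
  with assms have "complete_edges 2 - {e} = {}" by auto
  thus ?thesis by (simp only: randic_energy_no_edges)
qed

end

theory Submission
  imports Defs "HOL-Combinatorics.Transposition"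
begin

text \<open>
  Conjugating by the square roots of the degrees turns the Randic matrix into the random walk
  matrix \<open>D\<^sup>-\<^sup>1 A\<close>. Number the vertices so that the deleted edge is \<open>{1, 2}\<close>. In the basis
  consisting of the all-ones vector, \<open>e\<^sub>1 - e\<^sub>2\<close>, \<open>e\<^sub>2\<close>, \<open>e\<^sub>3\<close>, \<dots>, \<open>e\<^sub>n\<^sub>-\<^sub>1\<close> the
  random walk matrix is upper triangular with diagonal
  \<open>1, 0, -2/(n-1), -1/(n-1), \<dots>, -1/(n-1)\<close>.
\<close>

text \<open>A one-sided inverse of a square matrix is two-sided, so similarity follows from a right
  inverse of \<open>P\<close> and the inverse-free identity \<open>A * P = P * B\<close>, which can
  be checked entrywise.\<close>

lemma similar_mat_intertwining:
  fixes A B P Q :: "'a :: field mat"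
  assumes A: "A \<in> carrier_mat n n" and B: "B \<in> carrier_mat n n"
    and P: "P \<in> carrier_mat n n" and Q: "Q \<in> carrier_mat n n"
    and PQ: "P * Q = 1\<^sub>m n" and AP: "A * P = P * B"
  shows "similar_mat A B"
proof (rule similar_matI[of A B P Q n])
  show "Q * P = 1\<^sub>m n" using mat_mult_left_right_inverse[OF P Q PQ] .
  have "A = A * (P * Q)" using A PQ by simp
  also have "\<dots> = A * P * Q" using A P Q by simp
  finally show "A = P * B * Q" using AP by simp
qed (use assms in auto)

text \<open>The two denominators are the degrees after deletion of \<open>{1, 2}\<close>. Keeping
  vertex 0 off that edge lets the all-ones vector replace its unit vector in the basis.\<close>

definition walk_entry :: "nat \<Rightarrow> nat \<Rightarrow> nat \<Rightarrow> real" where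
  "walk_entry n i j = (if i = j \<or> {i, j} = {1, 2} then 0
     else 1 / (if i \<in> {1, 2} then real n - 2 else real n - 1))"

text \<open>Column \<open>j\<close> lists the coordinates of the image of basis vector
  \<open>j\<close>. Vertices 1 and 2 are non-adjacent twins, so \<open>e\<^sub>1 - e\<^sub>2\<close>
  goes to 0. For \<open>j \<ge> 3\<close> the image is \<open>u\<close> times all-ones, plus
  \<open>c\<close> times \<open>e\<^sub>1 + e\<^sub>2\<close>, minus \<open>u\<close> times
  \<open>e\<^sub>j\<close>; here \<open>e\<^sub>1 + e\<^sub>2 = (e\<^sub>1 - e\<^sub>2) + 2
  e\<^sub>2\<close>.\<close>

definition triangular_entry :: "nat \<Rightarrow> nat \<Rightarrow> nat \<Rightarrow> real" where
  "triangular_entry n i j =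
     (let u = 1 / (real n - 1); c = 1 / (real n - 2) - u in
      if j < i \<or> j = 1 then 0
      else if i = 0 then if j = 0 then 1 else u
      else if j = 2 then if i = 1 then - u else - (2 * u)
      else if i = 1 then c else if i = 2 then 2 * c else if i = j then - u else 0)"

lemma similar_walk_triangular:
  assumes n: "n \<ge> 3"
  shows "similar_mat (mat n n (\<lambda>(i, j). walk_entry n i j)) (mat n n (\<lambda>(i, j). triangular_entry n i j))"
    (is "similar_mat ?M ?T")
proof -
  \<comment> \<open>The walk matrix is row-stochastic, so it fixes the all-ones vector.\<close>
  have row_sum: "(\<Sum>k<n. walk_entry n i k) = 1" if "i < n" for i
  proof (cases "i \<in> {1, 2}")
    case True
    have "(\<Sum>k<n. walk_entry n i k) = (\<Sum>k\<in>{..<n} - {1, 2}. 1 / (real n - 2))"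
      using True by (intro sum.mono_neutral_cong_right) (auto simp: walk_entry_def doubleton_eq_iff)
    also have "card ({..<n} - {1, 2}) = n - 2" using n by (subst card_Diff_subset) auto
    hence "(\<Sum>k\<in>{..<n} - {1, 2}. 1 / (real n - 2)) = 1" using n by (simp add: of_nat_diff)
    finally show ?thesis .
  next
    case False
    have "(\<Sum>k<n. walk_entry n i k) = (\<Sum>k\<in>{..<n} - {i}. 1 / (real n - 1))"
      using False by (intro sum.mono_neutral_cong_right) (auto simp: walk_entry_def doubleton_eq_iff)
    also have "\<dots> = 1" using n that by (simp add: of_nat_diff)
    finally show ?thesis .
  qed
  \<comment> \<open>the columns of \<open>p\<close> are the all-ones vector, \<open>e\<^sub>1 - e\<^sub>2\<close>, \<open>e\<^sub>2\<close>, \<open>e\<^sub>3\<close>, \<open>\<dots>\<close>\<close>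
  define p :: "nat \<Rightarrow> nat \<Rightarrow> real" where
    "p i j = (if j = 0 \<or> i = j then 1 else 0) - (if i = 2 \<and> j = 1 then 1 else 0)" for i j
  define P where "P = mat n n (\<lambda>(i, j). p i j)"
  have P: "P \<in> carrier_mat n n" by (simp add: P_def)
  \<comment> \<open>\<open>P\<close> is lower triangular with unit diagonal, so an inverse exists
    without being computed.\<close>
  have "det P = prod_list (diag_mat P)"
    by (rule det_lower_triangular[OF _ P]) (auto simp: P_def p_def)
  also have "diag_mat P = map (\<lambda>i. 1) [0..<n]"
    by (auto simp: diag_mat_def P_def p_def)
  finally have "det P \<noteq> 0" by (simp add: map_replicate_const)
  from det_non_zero_imp_unit[OF P this]
  obtain Q where Q: "Q \<in> carrier_mat n n" "P * Q = 1\<^sub>m n"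
    by (auto simp: Units_def ring_mat_def)
  have "?M * P = P * ?T"
  proof (rule eq_matI)
    fix i j assume "i < dim_row (P * ?T)" "j < dim_col (P * ?T)"
    hence ij: "i < n" "j < n" by (auto simp: P_def)
    have "(?M * P) $$ (i, j) = (\<Sum>k<n. walk_entry n i k * p k j)"
      using ij by (simp add: P_def scalar_prod_def atLeast0LessThan)
    \<comment> \<open>Column 0 of \<open>P\<close> yields the row sum, column 1 the difference of
      two columns of the walk matrix; every other column is left as it is.\<close>
    also have "\<dots> = (if j = 0 then 1
        else walk_entry n i j - (if j = 1 then walk_entry n i 2 else 0))"
    proof (cases "j = 0")
      case True
      then show ?thesis using row_sum[OF ij(1)] by (simp add: p_def)
    next
      case False
      have "(\<Sum>k<n. walk_entry n i k * p k j)
        = (\<Sum>k<n. if k = j then walk_entry n i k else 0)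
          - (\<Sum>k<n. if k = 2 then if j = 1 then walk_entry n i k else 0 else 0)"
        unfolding sum_subtractf[symmetric] using False
        by (intro sum.cong) (auto simp: p_def)
      then show ?thesis using False ij n by simp
    qed
    \<comment> \<open>Row \<open>i\<close> of \<open>P\<close> has a 1 in column 0, a 1 on the
      diagonal and, if \<open>i = 2\<close>, a -1 in column 1. The case \<open>i = 0\<close> keeps a
      single 1 from being counted twice.\<close>
    also have "\<dots> = triangular_entry n 0 j + (if i = 0 then 0 else triangular_entry n i j)
        - (if i = 2 then triangular_entry n 1 j else 0)"
    proof -
      \<comment> \<open>With both fractions as atoms, the identity is linear in \<open>u\<close> and
        \<open>v\<close> for each kind of column.\<close>
      define u v where "u = 1 / (real n - 1)" and "v = 1 / (real n - 2)"
      show ?thesis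
      proof -
        consider "j = 0" | "j = 1" | "j = 2" | "j \<ge> 3" by linarith
        then show ?thesis
          by cases (simp_all add: walk_entry_def triangular_entry_def Let_def doubleton_eq_iff
              flip: u_def v_def)
      qed
    qed
    also have "\<dots> = (\<Sum>k<n. if k = 0 then triangular_entry n k j else 0)
        + (\<Sum>k<n. if k = i then if i = 0 then 0 else triangular_entry n k j else 0)
        - (\<Sum>k<n. if k = 1 then if i = 2 then triangular_entry n k j else 0 else 0)"
      using ij n by simp
    also have "\<dots> = (\<Sum>k<n. p i k * triangular_entry n k j)"
      unfolding sum_subtractf[symmetric] sum.distrib[symmetric]
      by (intro sum.cong) (auto simp: p_def)
    also have "\<dots> = (P * ?T) $$ (i, j)"
      using ij by (simp add: P_def scalar_prod_def atLeast0LessThan)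
    finally show "(?M * P) $$ (i, j) = (P * ?T) $$ (i, j)" .
  qed (auto simp: P_def)
  then show ?thesis
    using P Q by (intro similar_mat_intertwining[of _ n _ P Q]) auto
qed

lemma char_poly_triangular:
  assumes n: "n \<ge> 3"
  shows "char_poly (mat n n (\<lambda>(i, j). triangular_entry n i j)) =
    [:0, 1:] * [:-1, 1:] * [:2 / (real n - 1), 1:] * [:1 / (real n - 1), 1:] ^ (n - 3)"
    (is "char_poly ?T = _")
proof -
  have "upper_triangular ?T"
    by (rule upper_triangularI) (simp add: triangular_entry_def Let_def)
  then have "char_poly ?T = (\<Prod>a\<leftarrow>diag_mat ?T. [:- a, 1:])"
    by (intro char_poly_upper_triangular[of _ n]) auto
  also have "diag_mat ?T = map (\<lambda>i. triangular_entry n i i) [0..<n]"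
    by (auto simp: diag_mat_def)
  also have "[0..<n] = [0, 1, 2] @ [3..<n]"
    using n by (simp add: upt_conv_Cons numeral_2_eq_2 numeral_3_eq_3)
  also have "map (\<lambda>i. triangular_entry n i i) \<dots> =
      [1, 0, - (2 / (real n - 1))] @ replicate (n - 3) (- (1 / (real n - 1)))"
  proof -
    have "map (\<lambda>i. triangular_entry n i i) [3..<n] = map (\<lambda>i. - (1 / (real n - 1))) [3..<n]"
      by (rule map_cong) (simp_all add: triangular_entry_def Let_def)
    then show ?thesis by (simp add: triangular_entry_def Let_def map_replicate_const)
  qed
  finally show ?thesis
    by (simp only: map_append list.map map_replicate prod_list_replicate prod_list.append
        prod_list.Cons prod_list.Nil minus_zero minus_minus mult_1_right mult_ac)
qed

text \<open>One monomial matrix \<open>P\<close> both relabels and rescales: its column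
  \<open>j\<close> is \<open>g (s j)\<close> times the unit vector at \<open>s j\<close>.\<close>

lemma similar_mat_reindex_rescale:
  fixes f :: "nat \<Rightarrow> nat \<Rightarrow> 'a :: field"
  assumes s: "bij_betw s {..<n} {..<n}" and g: "\<And>i. i < n \<Longrightarrow> g i \<noteq> 0"
  shows "similar_mat (mat n n (\<lambda>(i, j). f i j))
           (mat n n (\<lambda>(i, j). f (s i) (s j) * g (s j) / g (s i)))"
    (is "similar_mat ?A ?B")
proof -
  define P where "P = mat n n (\<lambda>(i, j). if i = s j then g i else 0)"
  define Q where "Q = mat n n (\<lambda>(i, j). if s i = j then 1 / g j else 0)"
  have s_less: "s i < n" if "i < n" for i
    using s that by (auto simp: bij_betw_def)
  \<comment> \<open>Row \<open>i\<close> of \<open>P\<close> has a single nonzero entry, at the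
    preimage of \<open>i\<close>; summing along \<open>s\<close> avoids naming the inverse of
    \<open>s\<close>.\<close>
  have P_row: "(\<Sum>k<n. (if i = s k then g i else 0) * h (s k)) = g i * h i" if "i < n" for i h
  proof -
    have "(\<Sum>k<n. (if i = s k then g i else 0) * h (s k))
        = (\<Sum>k<n. (if i = k then g i else 0) * h k)"
      by (rule sum.reindex_bij_betw[OF s])
    also have "\<dots> = g i * h i" using that by (simp add: if_distrib[of "\<lambda>x. x * _"] cong: if_cong)
    finally show ?thesis .
  qed
  have "P * Q = 1\<^sub>m n"
  proof (rule eq_matI)
    fix i j assume "i < dim_row (1\<^sub>m n :: 'a mat)" "j < dim_col (1\<^sub>m n :: 'a mat)"
    hence ij: "i < n" "j < n" by auto
    have "(P * Q) $$ (i, j)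
        = (\<Sum>k<n. (if i = s k then g i else 0) * (if s k = j then 1 / g j else 0))"
      using ij by (simp add: P_def Q_def scalar_prod_def atLeast0LessThan)
    also have "\<dots> = g i * (if i = j then 1 / g j else 0)"
      by (rule P_row[OF ij(1)])
    also have "\<dots> = 1\<^sub>m n $$ (i, j)" using ij g by simp
    finally show "(P * Q) $$ (i, j) = 1\<^sub>m n $$ (i, j)" .
  qed (auto simp: P_def Q_def)
  moreover have "?A * P = P * ?B"
  proof (rule eq_matI)
    fix i j assume "i < dim_row (P * ?B)" "j < dim_col (P * ?B)"
    hence ij: "i < n" "j < n" by (auto simp: P_def)
    have "(?A * P) $$ (i, j) = (\<Sum>k<n. f i k * (if k = s j then g k else 0))"
      using ij by (simp add: P_def scalar_prod_def atLeast0LessThan)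
    also have "\<dots> = f i (s j) * g (s j)"
      using s_less[OF ij(2)] by (simp add: if_distrib[of "\<lambda>x. _ * x"] cong: if_cong)
    also have "\<dots> = g i * (f i (s j) * g (s j) / g i)" using g[OF ij(1)] by simp
    also have "\<dots> = (\<Sum>k<n. (if i = s k then g i else 0) * (f (s k) (s j) * g (s j) / g (s k)))"
      by (rule P_row[OF ij(1), symmetric])
    also have "\<dots> = (P * ?B) $$ (i, j)"
      using ij by (simp add: P_def scalar_prod_def atLeast0LessThan)
    finally show "(?A * P) $$ (i, j) = (P * ?B) $$ (i, j)" .
  qed (auto simp: P_def)
  ultimately show ?thesis
    by (intro similar_mat_intertwining[of _ n _ P Q]) (auto simp: P_def Q_def)
qed

lemma degree_of_complete_minus_edge:
  assumes "e \<in> complete_edges n" and "v < n"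
  shows "degree_of (complete_edges n - {e}) v = (if v \<in> e then n - 2 else n - 1)"
proof -
  \<comment> \<open>An edge at \<open>v\<close> is determined by its other end point.\<close>
  have "{f \<in> complete_edges n. v \<in> f} = (\<lambda>w. {v, w}) ` ({..<n} - {v})"
    using \<open>v < n\<close> by (auto simp: complete_edges_def card_2_iff doubleton_eq_iff image_iff)
  moreover have "inj_on (\<lambda>w. {v, w}) ({..<n} - {v})"
    by (auto simp: inj_on_def doubleton_eq_iff)
  ultimately have "card {f \<in> complete_edges n. v \<in> f} = n - 1"
    using \<open>v < n\<close> by (simp add: card_image)
  moreover have "{f \<in> complete_edges n - {e}. v \<in> f}
      = {f \<in> complete_edges n. v \<in> f} - (if v \<in> e then {e} else {})" by auto
  ultimately show ?thesis
    unfolding degree_of_def using \<open>e \<in> complete_edges n\<close>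
    by (cases "v \<in> e") (simp_all only: if_True if_False Diff_empty card_Diff_singleton
        mem_Collect_eq simp_thms diff_diff_left one_add_one)
qed

lemma ex_bij_betw_two_points:
  fixes n :: nat
  assumes "p < n" "q < n" "p \<noteq> q" "a < n" "b < n" "a \<noteq> b"
  shows "\<exists>s. bij_betw s {..<n} {..<n} \<and> s p = a \<and> s q = b"
proof -
  \<comment> \<open>Swapping \<open>a\<close> and \<open>p\<close> sends \<open>p\<close> to
    \<open>a\<close> and \<open>q\<close> to \<open>x\<close>. The second swap moves
    \<open>x\<close> to \<open>b\<close> and fixes \<open>a\<close>, which is neither
    \<open>x\<close> nor \<open>b\<close>.\<close>
  define x where "x = transpose a p q"
  have "x < n" "x \<noteq> a" using assms by (auto simp: x_def transpose_def)
  have "bij_betw (transpose b x \<circ> transpose a p) {..<n} {..<n}"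
    using assms \<open>x < n\<close>
    by (intro bij_betw_trans[of _ _ "{..<n}"] bij_betw_transpose_iff) auto
  moreover have "(transpose b x \<circ> transpose a p) p = a" "(transpose b x \<circ> transpose a p) q = b"
    using \<open>x \<noteq> a\<close> \<open>a \<noteq> b\<close> by (auto simp: x_def[symmetric])
  ultimately show ?thesis by blast
qed

text \<open>Relabel so that the ends of \<open>e\<close> become 1 and 2, and rescale by the square
  roots of the degrees: \<open>sqrt (d j) / (sqrt (d i * d j) * sqrt (d i)) = 1 / d i\<close> turns
  the symmetric normalisation into division by row degrees.\<close>

lemma similar_randic_complete_minus_edge:
  assumes n: "n \<ge> 3" and e: "e \<in> complete_edges n"
  shows "similar_mat (randic_matrix n (complete_edges n - {e})) (mat n n (\<lambda>(i, j). walk_entry n i j))"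
proof -
  obtain a b where ab: "e = {a, b}" "a \<noteq> b" "a < n" "b < n"
    using e by (auto simp: complete_edges_def card_2_iff)
  obtain s where s: "bij_betw s {..<n} {..<n}" "s 1 = a" "s 2 = b"
    using ex_bij_betw_two_points[of 1 n 2 a b] ab n by auto
  define E where "E = complete_edges n - {e}"
  define d where "d v = real (degree_of E v)" for v
  have d: "d v = (if v \<in> e then real n - 2 else real n - 1)" if "v < n" for v
    using degree_of_complete_minus_edge[OF e that] n by (auto simp: d_def E_def of_nat_diff)
  \<comment> \<open>Here \<open>n \<ge> 3\<close> matters: the ends of \<open>e\<close> keep degree
    \<open>n - 2 \<ge> 1\<close>.\<close>
  have d_pos: "d v > 0" if "v < n" for v using d[OF that] n by auto
  have s_less: "s i < n" if "i < n" for i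
    using s(1) that by (auto simp: bij_betw_def)
  have s_eq: "s i = s j \<longleftrightarrow> i = j" if "i < n" "j < n" for i j
    using s(1) that by (auto simp: bij_betw_def inj_on_def)
  have in_e: "s i \<in> e \<longleftrightarrow> i \<in> {1, 2}" if "i < n" for i
    using s_eq[of i 1] s_eq[of i 2] that n ab s by auto
  have edge: "{s i, s j} \<in> E \<longleftrightarrow> i \<noteq> j \<and> {i, j} \<noteq> {1, 2}" if "i < n" "j < n" for i j
  proof -
    have "{s i, s j} = e \<longleftrightarrow> {i, j} = {1, 2}"
      using s_eq[of i 1] s_eq[of i 2] s_eq[of j 1] s_eq[of j 2] that n ab s
      by (auto simp: doubleton_eq_iff)
    moreover have "{s i, s j} \<in> complete_edges n \<longleftrightarrow> i \<noteq> j"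
      using that s_less s_eq[OF that] by (auto simp: complete_edges_def card_insert_if)
    ultimately show ?thesis by (auto simp: E_def)
  qed
  define f where "f i j = (if {i, j} \<in> E then 1 / sqrt (d i * d j) else 0)" for i j
  have "similar_mat (mat n n (\<lambda>(i, j). f i j))
      (mat n n (\<lambda>(i, j). f (s i) (s j) * sqrt (d (s j)) / sqrt (d (s i))))"
    by (rule similar_mat_reindex_rescale[OF s(1)]) (use d_pos in force)
  moreover have "f (s i) (s j) * sqrt (d (s j)) / sqrt (d (s i)) = walk_entry n i j"
    if ij: "i < n" "j < n" for i j
  proof (cases "{s i, s j} \<in> E")
    case True
    have "f (s i) (s j) * sqrt (d (s j)) / sqrt (d (s i)) = 1 / d (s i)"
      using True d_pos[OF s_less[OF ij(1)]] d_pos[OF s_less[OF ij(2)]]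
      by (simp add: f_def real_sqrt_mult)
    also have "\<dots> = walk_entry n i j"
      using True edge[OF ij] d[OF s_less[OF ij(1)]] in_e[OF ij(1)] by (simp add: walk_entry_def)
    finally show ?thesis .
  next
    case False
    then show ?thesis using edge[OF ij] by (auto simp: f_def walk_entry_def)
  qed
  then have "mat n n (\<lambda>(i, j). f (s i) (s j) * sqrt (d (s j)) / sqrt (d (s i)))
      = mat n n (\<lambda>(i, j). walk_entry n i j)"
    by (intro eq_matI) auto
  moreover have "mat n n (\<lambda>(i, j). f i j) = randic_matrix n E"
    by (intro eq_matI) (auto simp: randic_matrix_def f_def d_def)
  ultimately show ?thesis by (simp add: E_def)
qed

lemma randic_energy_eq_sum_superset:
  assumes "finite S" and "\<And>x. poly (randic_char_poly n E) x = 0 \<Longrightarrow> x \<in> S"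
  shows "randic_energy n E = (\<Sum>x\<in>S. real (order x (randic_char_poly n E)) * \<bar>x\<bar>)"
proof -
  have "eigenvalue (randic_matrix n E) x \<longleftrightarrow> poly (randic_char_poly n E) x = 0" for x
    unfolding randic_char_poly_def
    by (rule eigenvalue_root_char_poly[of _ n]) (simp add: randic_matrix_def)
  then show ?thesis
    unfolding randic_energy_def using assms
    by (intro sum.mono_neutral_left) (auto intro: order_0I)
qed

theorem theorem8:
  fixes n :: nat and e :: "nat set"
  assumes "n \<ge> 3" and "e \<in> complete_edges n"
  shows "randic_char_poly n (complete_edges n - {e}) =
           [:0, 1:] * [:-1, 1:] * [:2 / (real n - 1), 1:] * [:1 / (real n - 1), 1:] ^ (n - 3)
         \<and> randic_energy n (complete_edges n - {e}) = 2"
proof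
  define E where "E = complete_edges n - {e}"
  define m where "m = real n - 1"
  have m: "m \<ge> 2" using assms(1) by (simp add: m_def)
  show "randic_char_poly n (complete_edges n - {e}) =
      [:0, 1:] * [:-1, 1:] * [:2 / (real n - 1), 1:] * [:1 / (real n - 1), 1:] ^ (n - 3)"
    unfolding randic_char_poly_def
    using char_poly_similar[OF similar_randic_complete_minus_edge[OF assms]]
      char_poly_similar[OF similar_walk_triangular[OF assms(1)]]
      char_poly_triangular[OF assms(1)] by simp
  \<comment> \<open>The exponents 1 let a single rule for powers of linear factors treat all four
    factors.\<close>
  then have RP: "randic_char_poly n E =
      [:0, 1:] ^ 1 * [:-1, 1:] ^ 1 * [:2 / m, 1:] ^ 1 * [:1 / m, 1:] ^ (n - 3)"
    by (simp add: E_def m_def)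
  have order_linear_power: "order x ([:b, 1:] ^ k) = (if x = - b then k else 0)" for x b :: real and k
    using order_power_n_n[of x k] by (cases "x = - b") (auto intro: order_0I)
  \<comment> \<open>Orders add over factors, so the indicators can be summed before the four values
    are known to be distinct.\<close>
  have ord: "order x (randic_char_poly n E) =
      (if x = 0 then 1 else 0) + (if x = 1 then 1 else 0) + (if x = - (2 / m) then 1 else 0)
      + (if x = - (1 / m) then n - 3 else 0)" for x
    unfolding RP
    by (simp only: order_mult order_linear_power mult_eq_0_iff power_eq_0_iff pCons_eq_0_iff
        one_neq_zero minus_zero minus_minus simp_thms)
  have "poly (randic_char_poly n E) x = 0 \<Longrightarrow> x \<in> {0, 1, - (2 / m), - (1 / m)}" for x
    unfolding RP poly_mult poly_power mult_eq_0_iff by (auto simp: add_eq_0_iff)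
  then have "randic_energy n E =
      (\<Sum>x\<in>{0, 1, - (2 / m), - (1 / m)}. real (order x (randic_char_poly n E)) * \<bar>x\<bar>)"
    by (intro randic_energy_eq_sum_superset) auto
  also have "\<dots> = 1 + 2 / m + real (n - 3) * (1 / m)"
  proof -
    \<comment> \<open>Positivity and \<open>y \<noteq> z\<close> make 0, 1, \<open>- y\<close>,
      \<open>- z\<close> distinct, so the sum splits into one term for each.\<close>
    obtain y z where yz: "2 / m = y" "1 / m = z" by blast
    have "0 < y" "0 < z" "y \<noteq> z" using m by (auto simp flip: yz)
    moreover from this have "1 \<noteq> - y" "1 \<noteq> - z" by linarith+
    ultimately show ?thesis unfolding ord yz by simp
  qed
  also have "\<dots> = 2"
  proof -
    have "real (n - 3) = m - 2" using assms(1) by (simp add: m_def of_nat_diff)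
    then show ?thesis using m by (simp add: diff_divide_distrib)
  qed
  finally show "randic_energy n (complete_edges n - {e}) = 2" by (simp add: E_def)
qed

end
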